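(* Let $K\subseteq\mathbb{R}^n$ be a proper convex cone and let $f\in\mathbb{R}[x_1,\dots,x_n]$ be a nonzero $K$-CLC polynomial. Let $d=\deg f$ and let $x,v\in\operatorname{int}K$. Then the sequence $$\bigl\{f(x),\,D_vf(x),\,D_v^2f(x),\,\dots,\,D_v^df(x)\bigr\}$$ consists of positive real numbers and is log-concave, i.e. $(D_v^kf(x))^2\ge D_v^{k-1}f(x)\,D_v^{k+1}f(x)$ for $1\le k\le d-1$.
   Context: A proper convex cone $K\subseteq\mathbb{R}^n$ is a nonempty convex set with $cK\subseteq K$ for all $c\ge0$ that is closed, pointed ($K\cap(-K)=\{0\}$) and has nonempty interior $\operatorname{int}K$. For $a\in\mathbb{R}^n$, $D_af=\sum_i a_i\,\partial f/\partial x_i$, and $D_v^k$ is the $k$-fold iterate of $D_v$. A polynomial $f$ is log-concave at a point $a$ if $f(a)>0$ and the Hessian of $\log f$ at $a$ is negative semidefinite; by convention the zero polynomial is log-concave at all points. A polynomial $f$ of degree $d$ is $K$-completely log-concave ($K$-CLC) if for all $0\le m\le d$ and all $a_1,\dots,a_m\in K$, the polynomial $D_{a_1}\cdots D_{a_m}f$ is log-concave at every point of $\operatorname{int}K$. *)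

theory Defs
  imports "HOL-Analysis.Analysis" "HOL-Library.Poly_Mapping"
begin

text \<open>
  A real polynomial in variables indexed by \<open>'n\<close> is a finitely supported map from monomials
  (exponent vectors \<open>'n \<Rightarrow>\<^sub>0 nat\<close>) to coefficients; the ring operations are those of
  \<^theory>\<open>HOL-Library.Poly_Mapping\<close>.
\<close>

type_synonym 'n rpoly = "('n \<Rightarrow>\<^sub>0 nat) \<Rightarrow>\<^sub>0 real"

definition poly_eval :: "'n::finite rpoly \<Rightarrow> real ^ 'n \<Rightarrow> real" where
  "poly_eval f x =
     (\<Sum>m\<in>Poly_Mapping.keys f. Poly_Mapping.lookup f m * (\<Prod>i\<in>UNIV. (x $ i) ^ Poly_Mapping.lookup m i))"

text \<open>The zero polynomial gets degree 0.\<close>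

definition total_degree :: "'n::finite rpoly \<Rightarrow> nat" where
  "total_degree f =
     Max (insert 0 ((\<lambda>m. \<Sum>i\<in>UNIV. Poly_Mapping.lookup m i) ` Poly_Mapping.keys f))"

text \<open>The exponent subtraction truncates, but only for terms whose new coefficient is 0.\<close>

definition partial :: "'n::finite \<Rightarrow> 'n rpoly \<Rightarrow> 'n rpoly" where
  "partial i f =
     (\<Sum>m\<in>Poly_Mapping.keys f. Poly_Mapping.single (m - Poly_Mapping.single i 1)
        (real (Poly_Mapping.lookup m i) * Poly_Mapping.lookup f m))"

definition dir_deriv :: "real ^ 'n \<Rightarrow> 'n::finite rpoly \<Rightarrow> 'n rpoly" where
  "dir_deriv a f = (\<Sum>i\<in>UNIV. Poly_Mapping.single 0 (a $ i) * partial i f)"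

definition dir_derivs :: "(real ^ 'n) list \<Rightarrow> 'n::finite rpoly \<Rightarrow> 'n rpoly" where
  "dir_derivs as f = foldr dir_deriv as f"

definition proper_convex_cone :: "(real ^ 'n::finite) set \<Rightarrow> bool" where
  "proper_convex_cone K \<longleftrightarrow>
     K \<noteq> {} \<and> convex K \<and> cone K \<and> closed K \<and> K \<inter> uminus ` K = {0} \<and> interior K \<noteq> {}"

definition fun_partial :: "'n::finite \<Rightarrow> (real ^ 'n \<Rightarrow> real) \<Rightarrow> real ^ 'n \<Rightarrow> real" where
  "fun_partial i g x = deriv (\<lambda>t. g (x + t *\<^sub>R axis i 1)) 0"

definition hessian :: "(real ^ 'n::finite \<Rightarrow> real) \<Rightarrow> real ^ 'n \<Rightarrow> real ^ 'n ^ 'n" where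
  "hessian g x = (\<chi> i j. fun_partial i (fun_partial j g) x)"

definition neg_semidef :: "real ^ 'n ^ 'n::finite \<Rightarrow> bool" where
  "neg_semidef A \<longleftrightarrow> (\<forall>w. w \<bullet> (A *v w) \<le> 0)"

text \<open>
  The Hessian of the logarithm is only consulted where \<open>f(a) > 0\<close>, hence where
  \<open>ln \<circ> poly_eval f\<close> is smooth in a neighbourhood of \<open>a\<close>.
\<close>

definition log_concave_at :: "'n::finite rpoly \<Rightarrow> real ^ 'n \<Rightarrow> bool" where
  "log_concave_at f a \<longleftrightarrow>
     f = 0 \<or> (poly_eval f a > 0 \<and> neg_semidef (hessian (\<lambda>y. ln (poly_eval f y)) a))"

definition completely_log_concave :: "(real ^ 'n) set \<Rightarrow> 'n::finite rpoly \<Rightarrow> bool" where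
  "completely_log_concave K f \<longleftrightarrow>
     (\<forall>as. length as \<le> total_degree f \<and> set as \<subseteq> K \<longrightarrow>
        (\<forall>y\<in>interior K. log_concave_at (dir_derivs as f) y))"

end

theory Submission
  imports Defs
begin

text \<open>
  Log-concavity of a polynomial \<open>g\<close> at a point forces the inequality
  \<open>(D\<^sub>v g)\<^sup>2 \<ge> g D\<^sub>v\<^sup>2 g\<close> there, since the second derivative of \<open>ln g\<close> along \<open>v\<close> is
  \<open>(g D\<^sub>v\<^sup>2 g - (D\<^sub>v g)\<^sup>2) / g\<^sup>2\<close>. For \<open>g = D\<^sub>v\<^bsup>k-1\<^esup> f\<close> this is the log-concavity of the
  sequence (\<open>log_concave_at_imp_Newton\<close>).

  Positivity is the more delicate part. Each \<open>D\<^sub>v\<^sup>k f\<close> with \<open>k \<le> deg f\<close> is log-concave at \<open>x\<close>, hence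
  positive there unless it is the zero polynomial, so it remains to see that it is not zero.
  Suppose that \<open>D\<^sub>v\<^sup>k f = 0\<close>. Since \<open>v\<close> is interior, it dominates a positive multiple of every
  \<open>b \<in> K\<close>, and since iterated derivatives along \<open>K\<close> are nonnegative at \<open>x\<close>, replacing one \<open>D\<^sub>v\<close>
  after the other by such a \<open>D\<^sub>b\<close> keeps the derivative zero
  (\<open>dir_deriv_power_zero_imp_dir_derivs_zero\<close>). Thus all \<open>k\<close>-fold derivatives of \<open>f\<close> along \<open>K\<close>
  vanish. But \<open>K\<close> spans the space, so a polynomial with a monomial of degree at least \<open>k\<close> has a
  nonzero \<open>k\<close>-fold derivative along \<open>K\<close> (\<open>ex_dir_derivs_nonzero\<close>), a contradiction.
\<close>

section \<open>Evaluation and differentiation of polynomials\<close>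

lemma poly_eval_superset:
  assumes "finite S" "Poly_Mapping.keys f \<subseteq> S"
  shows "poly_eval f x =
    (\<Sum>m\<in>S. Poly_Mapping.lookup f m * (\<Prod>i\<in>UNIV. (x $ i) ^ Poly_Mapping.lookup m i))"
  unfolding poly_eval_def
  by (rule sum.mono_neutral_left) (use assms in \<open>auto simp: in_keys_iff\<close>)

lemma poly_eval_zero [simp]: "poly_eval 0 x = 0"
  by (simp add: poly_eval_def)

lemma poly_eval_add: "poly_eval (f + g) x = poly_eval f x + poly_eval g x"
proof -
  let ?S = "Poly_Mapping.keys f \<union> Poly_Mapping.keys g"
  have "poly_eval (f + g) x = (\<Sum>m\<in>?S. Poly_Mapping.lookup (f + g) m *
      (\<Prod>i\<in>UNIV. (x $ i) ^ Poly_Mapping.lookup m i))"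
    by (rule poly_eval_superset) (auto dest: subsetD[OF Poly_Mapping.keys_add])
  moreover have "poly_eval f x = (\<Sum>m\<in>?S. Poly_Mapping.lookup f m *
      (\<Prod>i\<in>UNIV. (x $ i) ^ Poly_Mapping.lookup m i))"
    by (rule poly_eval_superset) auto
  moreover have "poly_eval g x = (\<Sum>m\<in>?S. Poly_Mapping.lookup g m *
      (\<Prod>i\<in>UNIV. (x $ i) ^ Poly_Mapping.lookup m i))"
    by (rule poly_eval_superset) auto
  ultimately show ?thesis
    by (simp add: lookup_add distrib_right sum.distrib)
qed

lemma poly_eval_sum: "poly_eval (sum F A) x = (\<Sum>a\<in>A. poly_eval (F a) x)"
  by (induction A rule: infinite_finite_induct) (auto simp: poly_eval_add)

lemma poly_eval_single:
  "poly_eval (Poly_Mapping.single m c) x = c * (\<Prod>i\<in>UNIV. (x $ i) ^ Poly_Mapping.lookup m i)"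
  by (simp add: poly_eval_def)

lemma lookup_const_mult:
  fixes f :: "'n rpoly"
  shows "Poly_Mapping.lookup (Poly_Mapping.single 0 c * f) m = c * Poly_Mapping.lookup f m"
  by (simp flip: mult_map_scale_conv_mult add: Poly_Mapping.map.rep_eq when_def)

lemma poly_eval_const_mult:
  "poly_eval (Poly_Mapping.single 0 c * f) x = c * poly_eval f x"
proof -
  have "poly_eval (Poly_Mapping.single 0 c * f) x =
     (\<Sum>m\<in>Poly_Mapping.keys f. Poly_Mapping.lookup (Poly_Mapping.single 0 c * f) m *
      (\<Prod>i\<in>UNIV. (x $ i) ^ Poly_Mapping.lookup m i))"
    by (rule poly_eval_superset) (auto simp: in_keys_iff lookup_const_mult)
  then show ?thesis
    by (simp add: lookup_const_mult poly_eval_def sum_distrib_left mult.assoc)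
qed

text \<open>The coefficient formula makes the linearity of \<^const>\<open>partial\<close> evident, in spite of
  the sum over the support in its definition.\<close>

lemma lookup_partial:
  "Poly_Mapping.lookup (partial i f) n =
     real (Suc (Poly_Mapping.lookup n i)) * Poly_Mapping.lookup f (n + Poly_Mapping.single i 1)"
proof -
  let ?e = "Poly_Mapping.single i (1::nat)"
  have eq: "Poly_Mapping.lookup (Poly_Mapping.single (m - ?e)
        (real (Poly_Mapping.lookup m i) * Poly_Mapping.lookup f m)) n =
      (if m = n + ?e then real (Suc (Poly_Mapping.lookup n i)) * Poly_Mapping.lookup f m else 0)" for m
  proof (cases "Poly_Mapping.lookup m i = 0")
    case True
    then show ?thesis by (auto simp: lookup_add)
  next
    case False
    have "m = (m - ?e) + ?e"
      by (rule poly_mapping_eqI) (use False in \<open>auto simp: lookup_add lookup_minus lookup_single when_def\<close>)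
    then have "m - ?e = n \<longleftrightarrow> m = n + ?e" by (metis add_diff_cancel_right')
    then show ?thesis by (auto simp: lookup_single when_def lookup_add)
  qed
  show ?thesis
    unfolding partial_def lookup_sum eq
    by (auto simp: sum.delta in_keys_iff)
qed

lemma lookup_dir_deriv:
  "Poly_Mapping.lookup (dir_deriv a f) n = (\<Sum>i\<in>UNIV. a $ i *
     (real (Suc (Poly_Mapping.lookup n i)) * Poly_Mapping.lookup f (n + Poly_Mapping.single i 1)))"
  by (simp add: dir_deriv_def lookup_sum lookup_const_mult lookup_partial)

lemma dir_deriv_add: "dir_deriv a (f + g) = dir_deriv a f + dir_deriv a g"
  by (rule poly_mapping_eqI)
    (simp add: lookup_dir_deriv lookup_add distrib_left sum.distrib)

lemma dir_deriv_const_mult: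
  "dir_deriv a (Poly_Mapping.single 0 c * f) = Poly_Mapping.single 0 c * dir_deriv a f"
  by (rule poly_mapping_eqI)
    (simp add: lookup_dir_deriv lookup_const_mult sum_distrib_left mult_ac[where 'a = real])

lemma dir_deriv_add_direction: "dir_deriv (a + b) f = dir_deriv a f + dir_deriv b f"
  by (rule poly_mapping_eqI)
    (simp add: lookup_dir_deriv lookup_add distrib_right sum.distrib)

lemma dir_deriv_scaleR_direction:
  "dir_deriv (c *\<^sub>R a) f = Poly_Mapping.single 0 c * dir_deriv a f"
  by (rule poly_mapping_eqI)
    (simp add: lookup_dir_deriv lookup_const_mult sum_distrib_left mult_ac[where 'a = real])

lemma dir_deriv_axis: "dir_deriv (axis i 1) f = partial i f"
proof (rule poly_mapping_eqI)
  fix n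
  show "Poly_Mapping.lookup (dir_deriv (axis i 1) f) n = Poly_Mapping.lookup (partial i f) n"
    unfolding lookup_dir_deriv lookup_partial
    by (simp add: axis_def if_distrib[of "\<lambda>u. u * _"] sum.delta cong: if_cong)
qed

lemma dir_deriv_power_add:
  "(dir_deriv v ^^ k) (f + g) = (dir_deriv v ^^ k) f + (dir_deriv v ^^ k) g"
  by (induction k) (auto simp: dir_deriv_add)

lemma dir_deriv_power_const_mult:
  "(dir_deriv v ^^ k) (Poly_Mapping.single 0 c * f) =
     Poly_Mapping.single 0 c * (dir_deriv v ^^ k) f"
  by (induction k) (auto simp: dir_deriv_const_mult)

lemma poly_eval_dir_deriv: "poly_eval (dir_deriv v f) x = (\<Sum>i\<in>UNIV. v $ i * poly_eval (partial i f) x)"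
  by (simp add: dir_deriv_def poly_eval_sum poly_eval_const_mult)

lemma poly_eval_dir_deriv_twice:
  "poly_eval (dir_deriv v (dir_deriv v f)) x =
     (\<Sum>i\<in>UNIV. \<Sum>j\<in>UNIV. v $ i * v $ j * poly_eval (partial i (partial j f)) x)"
proof -
  have "partial i (dir_deriv v f) =
      (\<Sum>j\<in>UNIV. Poly_Mapping.single 0 (v $ j) * partial i (partial j f))" for i
    by (rule poly_mapping_eqI)
      (simp add: lookup_dir_deriv lookup_partial lookup_sum lookup_const_mult sum_distrib_left mult_ac[where 'a = real])
  then show ?thesis
    by (simp add: poly_eval_dir_deriv poly_eval_sum poly_eval_const_mult sum_distrib_left mult.assoc)
qed

text \<open>Along the \<open>i\<close>-th axis every monomial is a constant times a power of \<open>x\<^sub>i + t\<close>, so only the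
  derivative of a power is needed. The parameter \<open>s\<close> is kept general because the second
  derivative requires the first in a whole neighbourhood.\<close>

lemma has_field_derivative_poly_eval_axis:
  fixes f :: "'n::finite rpoly"
  shows "((\<lambda>t. poly_eval f (x + t *\<^sub>R axis i 1)) has_field_derivative
      poly_eval (partial i f) (x + s *\<^sub>R axis i 1)) (at s)"
proof -
  let ?y = "\<lambda>t. x + t *\<^sub>R axis i (1::real)"
  let ?m = "\<lambda>m t. \<Prod>k\<in>UNIV. ?y t $ k ^ Poly_Mapping.lookup m k"
  have split: "(\<Prod>k\<in>UNIV. ?y t $ k ^ Poly_Mapping.lookup m k) =
     (x $ i + t) ^ Poly_Mapping.lookup m i * (\<Prod>k\<in>UNIV - {i}. x $ k ^ Poly_Mapping.lookup m k)"
    for m :: "'n \<Rightarrow>\<^sub>0 nat" and t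
  proof -
    have "(\<Prod>k\<in>UNIV. ?y t $ k ^ Poly_Mapping.lookup m k) =
       ?y t $ i ^ Poly_Mapping.lookup m i * (\<Prod>k\<in>UNIV - {i}. ?y t $ k ^ Poly_Mapping.lookup m k)"
      by (rule prod.remove) auto
    also have "(\<Prod>k\<in>UNIV - {i}. ?y t $ k ^ Poly_Mapping.lookup m k) =
        (\<Prod>k\<in>UNIV - {i}. x $ k ^ Poly_Mapping.lookup m k)"
      by (rule prod.cong) (auto simp: axis_def)
    finally show ?thesis by (simp add: axis_def)
  qed
  have deriv: "((\<lambda>t. Poly_Mapping.lookup f m * ?m m t) has_field_derivative
      (real (Poly_Mapping.lookup m i) * Poly_Mapping.lookup f m) *
        ?m (m - Poly_Mapping.single i 1) s) (at s)" for m
  proof -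
    let ?P = "\<Prod>k\<in>UNIV - {i}. x $ k ^ Poly_Mapping.lookup m k"
    have P: "(\<Prod>k\<in>UNIV - {i}. x $ k ^ Poly_Mapping.lookup (m - Poly_Mapping.single i 1) k) = ?P"
      by (rule prod.cong) (auto simp: lookup_minus lookup_single when_def)
    have e: "Poly_Mapping.lookup (m - Poly_Mapping.single i 1) i = Poly_Mapping.lookup m i - 1"
      by (simp add: lookup_minus)
    show ?thesis
      unfolding split P e
      by (auto intro!: derivative_eq_intros)
  qed
  show ?thesis
    unfolding partial_def poly_eval_sum poly_eval_single
    unfolding poly_eval_def
    by (intro DERIV_sum deriv)
qed

lemma fun_partial_ln_poly_eval:
  assumes "poly_eval g y > 0"
  shows "fun_partial j (\<lambda>y. ln (poly_eval g y)) y = poly_eval (partial j g) y / poly_eval g y"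
  unfolding fun_partial_def
  by (rule DERIV_imp_deriv)
    (use has_field_derivative_poly_eval_axis[of g y j 0] assms in
      \<open>auto intro!: derivative_eq_intros simp: divide_inverse\<close>)

lemma hessian_ln_poly_eval:
  assumes "poly_eval g x > 0"
  shows "hessian (\<lambda>y. ln (poly_eval g y)) x $ i $ j =
    (poly_eval (partial i (partial j g)) x * poly_eval g x
      - poly_eval (partial j g) x * poly_eval (partial i g) x) / (poly_eval g x)\<^sup>2"
proof -
  let ?y = "\<lambda>t. x + t *\<^sub>R axis i (1::real)"
  let ?F = "fun_partial j (\<lambda>y. ln (poly_eval g y))"
  have "isCont (\<lambda>t. poly_eval g (?y t)) 0"
    using has_field_derivative_poly_eval_axis by (rule DERIV_isCont)
  then have "\<forall>\<^sub>F t in at 0. poly_eval g (?y t) > 0"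
    using assms by (intro order_tendstoD(1)) (auto simp: isCont_def)
  then have "\<forall>\<^sub>F t in nhds 0. poly_eval g (?y t) > 0"
    using assms by (subst eventually_nhds_conv_at) simp
  then have ev: "\<forall>\<^sub>F t in nhds 0. ?F (?y t) = poly_eval (partial j g) (?y t) / poly_eval g (?y t)"
    by (rule eventually_mono) (rule fun_partial_ln_poly_eval)
  have "((\<lambda>t. poly_eval (partial j g) (?y t) / poly_eval g (?y t)) has_field_derivative
     (poly_eval (partial i (partial j g)) x * poly_eval g x
      - poly_eval (partial j g) x * poly_eval (partial i g) x) / (poly_eval g x)\<^sup>2) (at 0)"
    using has_field_derivative_poly_eval_axis[of g x i 0]
      has_field_derivative_poly_eval_axis[of "partial j g" x i 0] assms
    by (auto intro!: derivative_eq_intros simp: power2_eq_square)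
  \<comment> \<open>The formula for the inner derivative holds only where \<open>g > 0\<close>, but near \<open>x\<close> that is enough.\<close>
  then have "((\<lambda>t. ?F (?y t)) has_field_derivative
     (poly_eval (partial i (partial j g)) x * poly_eval g x
      - poly_eval (partial j g) x * poly_eval (partial i g) x) / (poly_eval g x)\<^sup>2) (at 0)"
    using DERIV_cong_ev[OF refl ev refl] by blast
  then show ?thesis
    by (simp add: hessian_def fun_partial_def[of i] DERIV_imp_deriv)
qed

section \<open>Log-concavity along a line\<close>

text \<open>The Hessian form of \<open>ln g\<close> at \<open>v\<close> equals \<open>(g D\<^sub>v\<^sup>2 g - (D\<^sub>v g)\<^sup>2) / g\<^sup>2\<close>, so its sign is that
  of the numerator.\<close>

lemma log_concave_at_imp_Newton:
  assumes "log_concave_at g x"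
  shows "(poly_eval (dir_deriv v g) x)\<^sup>2 \<ge> poly_eval g x * poly_eval (dir_deriv v (dir_deriv v g)) x"
proof (cases "g = 0")
  case False
  define c where "c = poly_eval g x"
  have c: "c > 0" and neg: "neg_semidef (hessian (\<lambda>y. ln (poly_eval g y)) x)"
    using assms False by (auto simp: log_concave_at_def c_def)
  let ?H = "hessian (\<lambda>y. ln (poly_eval g y)) x"
  let ?p = "\<lambda>i. poly_eval (partial i g) x"
  let ?q = "\<lambda>i j. poly_eval (partial i (partial j g)) x"
  have "v \<bullet> (?H *v v) = (\<Sum>i\<in>UNIV. \<Sum>j\<in>UNIV. v $ i * v $ j * ?H $ i $ j)"
    by (simp add: inner_vec_def matrix_vector_mult_def sum_distrib_left mult_ac)
  also have "\<dots> = (\<Sum>i\<in>UNIV. \<Sum>j\<in>UNIV.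
      (c * (v $ i * v $ j * ?q i j) - (v $ i * ?p i) * (v $ j * ?p j)) / c\<^sup>2)"
    using c unfolding c_def
    by (intro sum.cong refl) (simp add: hessian_ln_poly_eval algebra_simps diff_divide_distrib)
  also have "\<dots> = (c * (\<Sum>i\<in>UNIV. \<Sum>j\<in>UNIV. v $ i * v $ j * ?q i j)
      - (\<Sum>i\<in>UNIV. v $ i * ?p i) * (\<Sum>j\<in>UNIV. v $ j * ?p j)) / c\<^sup>2"
    by (subst sum_product) (simp only: sum_distrib_left sum_subtractf sum_divide_distrib diff_divide_distrib)
  also have "\<dots> = (c * poly_eval (dir_deriv v (dir_deriv v g)) x - (poly_eval (dir_deriv v g) x)\<^sup>2) / c\<^sup>2"
    by (simp add: poly_eval_dir_deriv_twice poly_eval_dir_deriv[of v g] power2_eq_square)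
  finally have "(c * poly_eval (dir_deriv v (dir_deriv v g)) x - (poly_eval (dir_deriv v g) x)\<^sup>2) / c\<^sup>2 \<le> 0"
    using neg unfolding neg_semidef_def by metis
  then show ?thesis using c by (simp add: divide_le_0_iff c_def)
qed simp

section \<open>Iterated derivatives do not vanish before the degree\<close>

lemma interior_add_scaleR:
  fixes v w :: "'a::real_normed_vector"
  assumes "v \<in> interior K"
  obtains e where "e > 0" "v + e *\<^sub>R w \<in> K"
proof -
  have "((\<lambda>e. v + e *\<^sub>R w) \<longlongrightarrow> v + 0 *\<^sub>R w) (at_right 0)"
    by (intro tendsto_intros)
  then have "\<forall>\<^sub>F e in at_right 0. v + e *\<^sub>R w \<in> interior K"
    by (rule topological_tendstoD) (use assms in auto)
  then have "\<forall>\<^sub>F e in at_right (0::real). e > 0 \<and> v + e *\<^sub>R w \<in> interior K"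
    using eventually_at_right_less by (rule eventually_conj[rotated])
  then obtain e where "e > 0" "v + e *\<^sub>R w \<in> interior K"
    using eventually_happens'[OF trivial_limit_at_right_real] by blast
  then show thesis using that interior_subset by blast
qed

text \<open>If \<open>\<partial>\<^sub>i g\<close> still has a monomial of degree at least \<open>m\<close>, so does one of \<open>D\<^sub>v g\<close> and
  \<open>D\<^bsub>v + e \<cdot> axis i\<^esub> g\<close>, since they differ by \<open>e \<cdot> \<partial>\<^sub>i g\<close>. This is where the nonempty interior of
  \<open>K\<close> enters: coordinate directions need not lie in \<open>K\<close>, but they are differences of
  directions that do.\<close>

lemma ex_dir_derivs_nonzero:
  assumes v: "v \<in> interior K"
    and "n \<in> Poly_Mapping.keys f" "(\<Sum>i\<in>UNIV. Poly_Mapping.lookup n i) \<ge> m"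
  shows "\<exists>bs. length bs = m \<and> set bs \<subseteq> K \<and> dir_derivs bs f \<noteq> 0"
  using assms(2,3)
proof (induction m arbitrary: f n)
  case 0
  then show ?case by (intro exI[of _ "[]"]) (auto simp: dir_derivs_def)
next
  case (Suc m)
  from Suc.prems(2) have "(\<Sum>i\<in>UNIV. Poly_Mapping.lookup n i) \<noteq> 0" by linarith
  then obtain i where i: "Poly_Mapping.lookup n i \<noteq> 0"
    by (meson sum.not_neutral_contains_not_neutral)
  define n' where "n' = n - Poly_Mapping.single i 1"
  have n: "n = n' + Poly_Mapping.single i 1"
    by (rule poly_mapping_eqI) (use i in \<open>auto simp: n'_def lookup_add lookup_minus lookup_single when_def\<close>)
  have "(\<Sum>k\<in>UNIV. Poly_Mapping.lookup n k) = Suc (\<Sum>k\<in>UNIV. Poly_Mapping.lookup n' k)"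
    by (simp add: n lookup_add sum.distrib lookup_single when_def)
  with Suc.prems(2) have deg: "(\<Sum>k\<in>UNIV. Poly_Mapping.lookup n' k) \<ge> m" by simp
  have nz: "Poly_Mapping.lookup (partial i f) n' \<noteq> 0"
    using Suc.prems(1) unfolding lookup_partial n[symmetric] by (simp add: in_keys_iff)
  obtain e where e: "e > 0" "v + e *\<^sub>R axis i 1 \<in> K"
    using interior_add_scaleR[OF v] .
  have "Poly_Mapping.lookup (dir_deriv (v + e *\<^sub>R axis i 1) f) n' =
      Poly_Mapping.lookup (dir_deriv v f) n' + e * Poly_Mapping.lookup (partial i f) n'"
    by (simp add: dir_deriv_add_direction dir_deriv_scaleR_direction dir_deriv_axis
        lookup_add lookup_const_mult)
  then have "Poly_Mapping.lookup (dir_deriv v f) n' \<noteq> 0 \<or>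
      Poly_Mapping.lookup (dir_deriv (v + e *\<^sub>R axis i 1) f) n' \<noteq> 0"
    using e(1) nz by auto
  then obtain b where b: "b \<in> K" "n' \<in> Poly_Mapping.keys (dir_deriv b f)"
    using e(2) v interior_subset unfolding in_keys_iff by blast
  from Suc.IH[OF b(2) deg] obtain bs
    where "length bs = m" "set bs \<subseteq> K" "dir_derivs bs (dir_deriv b f) \<noteq> 0" by blast
  with b(1) show ?case
    by (intro exI[of _ "bs @ [b]"]) (auto simp: dir_derivs_def)
qed

lemma dir_derivs_replicate_append:
  "dir_derivs (replicate j v @ bs) f = (dir_deriv v ^^ j) (dir_derivs bs f)"
  by (simp add: dir_derivs_def foldr_replicate)

lemma completely_log_concave_dichotomy:
  assumes "completely_log_concave K f" "x \<in> interior K"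
    and "length as \<le> total_degree f" "set as \<subseteq> K"
  shows "dir_derivs as f = 0 \<or> poly_eval (dir_derivs as f) x > 0"
  using assms unfolding completely_log_concave_def log_concave_at_def by blast

text \<open>The factors \<open>D\<^sub>v\<close> are traded one by one for the \<open>D\<^sub>b\<close>. Choosing \<open>e > 0\<close> with
  \<open>v - e b \<in> K\<close>, the operator \<open>D\<^sub>v = e D\<^sub>b + D\<^bsub>v - e b\<^esub>\<close> splits a vanishing derivative
  into two summands that are nonnegative at \<open>x\<close>; both vanish there, and a derivative
  that vanishes at an interior point is the zero polynomial.\<close>

lemma dir_deriv_power_zero_imp_dir_derivs_zero:
  assumes clc: "completely_log_concave K f" and x: "x \<in> interior K" and v: "v \<in> interior K"
    and "set bs \<subseteq> K" "j + length bs \<le> total_degree f"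
    and "(dir_deriv v ^^ (j + length bs)) f = 0"
  shows "(dir_deriv v ^^ j) (dir_derivs bs f) = 0"
  using assms(4-)
proof (induction bs arbitrary: j)
  case Nil
  then show ?case by (simp add: dir_derivs_def)
next
  case (Cons b bs)
  have vK: "v \<in> K" using v interior_subset by blast
  define h where "h = dir_derivs bs f"
  define E where "E a = (dir_deriv v ^^ j) (dir_deriv a h)" for a
  have E: "E a = dir_derivs (replicate j v @ a # bs) f" for a
    by (simp only: E_def h_def dir_derivs_replicate_append) (simp add: dir_derivs_def)
  have dich: "E a = 0 \<or> poly_eval (E a) x > 0" if "a \<in> K" for a
    unfolding E
    by (rule completely_log_concave_dichotomy[OF clc x]) (use that vK Cons.prems in auto)
  have "(dir_deriv v ^^ Suc j) h = 0"
    unfolding h_def by (rule Cons.IH) (use Cons.prems in auto)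
  then have Ev: "E v = 0" by (simp add: E_def funpow_swap1)
  obtain e where e: "e > 0" "v + e *\<^sub>R (- b) \<in> K"
    using interior_add_scaleR[OF v] .
  have "E v = E (v + e *\<^sub>R (- b) + e *\<^sub>R b)" by simp
  also have "\<dots> = E (v + e *\<^sub>R (- b)) + Poly_Mapping.single 0 e * E b"
    by (simp only: E_def dir_deriv_add_direction[of "v + e *\<^sub>R (- b)"] dir_deriv_scaleR_direction[of e b]
        dir_deriv_power_add dir_deriv_power_const_mult)
  finally have "poly_eval (E (v + e *\<^sub>R (- b))) x + e * poly_eval (E b) x = 0"
    using Ev by (metis poly_eval_add poly_eval_const_mult poly_eval_zero)
  moreover have "poly_eval (E (v + e *\<^sub>R (- b))) x \<ge> 0"
    using dich[OF e(2)] by auto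
  ultimately have "\<not> poly_eval (E b) x > 0"
    using e(1) by (smt (verit) mult_pos_pos)
  then have "E b = 0" using dich[of b] Cons.prems(1) by auto
  then show ?case by (simp add: E_def h_def dir_derivs_def)
qed

lemma completely_log_concave_dir_deriv_power_nonzero:
  assumes clc: "completely_log_concave K f" and "f \<noteq> 0" and v: "v \<in> interior K"
    and k: "k \<le> total_degree f"
  shows "(dir_deriv v ^^ k) f \<noteq> 0"
proof
  assume zero: "(dir_deriv v ^^ k) f = 0"
  let ?deg = "\<lambda>m. \<Sum>i\<in>UNIV. Poly_Mapping.lookup m i"
  have "total_degree f \<in> insert 0 (?deg ` Poly_Mapping.keys f)"
    unfolding total_degree_def by (rule Max_in) auto
  moreover obtain n0 where "n0 \<in> Poly_Mapping.keys f"
    using \<open>f \<noteq> 0\<close> by (metis all_not_in_conv keys_eq_empty)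
  \<comment> \<open>In degree 0 the maximum may come from the inserted 0, and any monomial will do.\<close>
  ultimately obtain n where "n \<in> Poly_Mapping.keys f" "?deg n \<ge> k"
    using k by (cases "total_degree f = 0") auto
  then obtain bs where "length bs = k" "set bs \<subseteq> K" "dir_derivs bs f \<noteq> 0"
    using ex_dir_derivs_nonzero[OF v] by blast
  with dir_deriv_power_zero_imp_dir_derivs_zero[OF clc v v, of bs 0] zero k
  show False by simp
qed

theorem theorem3p16:
  fixes K :: "(real ^ 'n::finite) set"
    and f :: "'n rpoly"
    and x v :: "real ^ 'n"
    and d :: nat
  assumes "proper_convex_cone K"
    and "f \<noteq> 0"
    and "completely_log_concave K f"
    and "d = total_degree f"
    and "x \<in> interior K"
    and "v \<in> interior K"
  shows "(\<forall>k\<le>d. poly_eval ((dir_deriv v ^^ k) f) x > 0) \<and>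
    (\<forall>k. 1 \<le> k \<and> k \<le> d - 1 \<longrightarrow>
       (poly_eval ((dir_deriv v ^^ k) f) x)\<^sup>2
         \<ge> poly_eval ((dir_deriv v ^^ (k - 1)) f) x * poly_eval ((dir_deriv v ^^ (k + 1)) f) x)"
proof -
  have "set (replicate k v) \<subseteq> K" for k
    using assms(6) interior_subset by fastforce
  moreover have "dir_derivs (replicate k v) f = (dir_deriv v ^^ k) f" for k
    by (simp add: dir_derivs_def foldr_replicate)
  ultimately have lc: "log_concave_at ((dir_deriv v ^^ k) f) x" if "k \<le> d" for k
    using assms(3-5) that unfolding completely_log_concave_def by (metis length_replicate)
  have "poly_eval ((dir_deriv v ^^ k) f) x > 0" if "k \<le> d" for k
    using lc[OF that] completely_log_concave_dir_deriv_power_nonzero[OF assms(3,2,6)] that assms(4)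
    unfolding log_concave_at_def by blast
  moreover have "(poly_eval ((dir_deriv v ^^ k) f) x)\<^sup>2
      \<ge> poly_eval ((dir_deriv v ^^ (k - 1)) f) x * poly_eval ((dir_deriv v ^^ (k + 1)) f) x"
    if k: "1 \<le> k \<and> k \<le> d - 1" for k
  proof -
    obtain l where l: "k = Suc l" using k by (cases k) auto
    have "log_concave_at ((dir_deriv v ^^ l) f) x" using k l by (intro lc) linarith
    from log_concave_at_imp_Newton[OF this, of v] show ?thesis by (simp add: l)
  qed
  ultimately show ?thesis by blast
qed

end
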